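(* For every function $f\colon\{0,1\}^n\to\mathbb{R}$ and every $S\subseteq N$, we have $$\Phi_{\mathrm{B},\mathbf{p}}(f,S)=(\sigma_S\bar f)(\mathbf{p})=\sum_{\mathbf{x}\in\{0,1\}^n}w(\mathbf{x})\,\sigma_Sf(\mathbf{x})=E\big[(\sigma_Sf)(C)\big],$$ where $C$ is a random subset of $N$ with $\Pr(C=T)=w(T)$ for every $T\subseteq N$.
   Context: Let $n\geqslant 1$, $N=\{1,\ldots,n\}$, and $\mathbf{p}=(p_1,\ldots,p_n)\in\,]0,1[^n$. Boolean vectors $\mathbf{x}\in\{0,1\}^n$ are identified with subsets $T\subseteq N$ via $x_i=1\iff i\in T$; functions on $\{0,1\}^n$ are thus also set functions on $2^N$. For $T\subseteq N$ let $u_T(\mathbf{x})=\prod_{i\in T}x_i$ (with $u_\varnothing=1$). Let $w(S)=\prod_{i\in S}p_i\prod_{i\in N\setminus S}(1-p_i)$ for $S\subseteq N$. For $S\subseteq N$ let $V_S$ be the linear span of $\{u_T:T\subseteq S\}$. The (weighted) best $S$-approximation of $f\colon\{0,1\}^n\to\mathbb{R}$ is the unique $f_{S,\mathbf{p}}\in V_S$ minimizing $\sum_{T\subseteq N}w(T)(f(T)-g(T))^2$ among all $g\in V_S$. The weighted Banzhaf influence index is $\Phi_{\mathrm{B},\mathbf{p}}(f,S)=f_{S,\mathbf{p}}(S)-f_{S,\mathbf{p}}(\varnothing)$. The multilinear extension of $f$ is $\bar f\colon[0,1]^n\to\mathbb{R}$, $\bar f(\mathbf{x})=\sum_{T\subseteq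 N}a(T)\prod_{i\in T}x_i$, where $a(S)=\sum_{T\subseteq S}(-1)^{|S|-|T|}f(T)$ is the Möbius transform of $f$. For a function $h$ on $\{0,1\}^n$ or on $[0,1]^n$, $$\sigma_Sh(\mathbf{x})=h(\mathbf{x}\mid x_i=1\ \forall i\in S)-h(\mathbf{x}\mid x_i=0\ \forall i\in S).$$ *)

theory Defs
  imports "HOL-Probability.Probability" "HOL-Library.Function_Algebras"
begin

text \<open>
  The index set \<open>N\<close> is the universe of a finite type \<open>'n\<close>. The cube \<open>{0,1}\<^sup>n\<close> is the type
  \<^typ>\<open>bool ^ 'n\<close>, and the two maps below are the identification of Boolean vectors with subsets.
\<close>

definition vec_of :: "'n::finite set \<Rightarrow> bool ^ 'n" where
  "vec_of T = (\<chi> i. i \<in> T)"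

definition set_of :: "bool ^ 'n::finite \<Rightarrow> 'n set" where
  "set_of x = {i. x $ i}"

definition u :: "'n::finite set \<Rightarrow> bool ^ 'n \<Rightarrow> real" where
  "u T x = (\<Prod>i\<in>T. of_bool (x $ i))"

definition weight :: "real ^ 'n::finite \<Rightarrow> 'n set \<Rightarrow> real" where
  "weight p S = (\<Prod>i\<in>S. p $ i) * (\<Prod>i\<in>UNIV - S. 1 - p $ i)"

definition fun_scale :: "real \<Rightarrow> ('a \<Rightarrow> real) \<Rightarrow> 'a \<Rightarrow> real" where
  "fun_scale c g = (\<lambda>x. c * g x)"

global_interpretation fun_space: vector_space fun_scale
  by unfold_locales (auto simp: fun_scale_def fun_eq_iff algebra_simps)

definition V :: "'n::finite set \<Rightarrow> (bool ^ 'n \<Rightarrow> real) set" where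
  "V S = fun_space.span {u T | T. T \<subseteq> S}"

definition sq_dist :: "real ^ 'n::finite \<Rightarrow> (bool ^ 'n \<Rightarrow> real) \<Rightarrow> (bool ^ 'n \<Rightarrow> real) \<Rightarrow> real" where
  "sq_dist p f g = (\<Sum>T\<in>UNIV. weight p T * (f (vec_of T) - g (vec_of T))\<^sup>2)"

text \<open>The minimizer exists and is unique when all \<open>p $ i\<close> lie strictly between 0 and 1.\<close>

definition best_approx ::
  "real ^ 'n::finite \<Rightarrow> 'n set \<Rightarrow> (bool ^ 'n \<Rightarrow> real) \<Rightarrow> (bool ^ 'n \<Rightarrow> real)" where
  "best_approx p S f = (THE g. is_arg_min (sq_dist p f) (\<lambda>g. g \<in> V S) g)"

definition banzhaf_influence ::
  "real ^ 'n::finite \<Rightarrow> (bool ^ 'n \<Rightarrow> real) \<Rightarrow> 'n set \<Rightarrow> real" where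
  "banzhaf_influence p f S =
     best_approx p S f (vec_of S) - best_approx p S f (vec_of {})"

definition moebius :: "(bool ^ 'n::finite \<Rightarrow> real) \<Rightarrow> 'n set \<Rightarrow> real" where
  "moebius f S = (\<Sum>T\<in>Pow S. (-1) ^ (card S - card T) * f (vec_of T))"

text \<open>As a polynomial, the multilinear extension is given on all of \<open>\<real>\<^sup>n\<close>, not only on \<open>[0,1]\<^sup>n\<close>.\<close>

definition mult_ext :: "(bool ^ 'n::finite \<Rightarrow> real) \<Rightarrow> real ^ 'n \<Rightarrow> real" where
  "mult_ext f x = (\<Sum>T\<in>UNIV. moebius f T * (\<Prod>i\<in>T. x $ i))"

definition fix_coords :: "'n::finite set \<Rightarrow> 'a \<Rightarrow> 'a ^ 'n \<Rightarrow> 'a ^ 'n" where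
  "fix_coords S c x = (\<chi> i. if i \<in> S then c else x $ i)"

text \<open>The operator \<open>\<sigma>\<^sub>S\<close>, for functions on \<open>{0,1}\<^sup>n\<close> and for functions of real vectors.\<close>

definition sigma_bool :: "'n::finite set \<Rightarrow> (bool ^ 'n \<Rightarrow> real) \<Rightarrow> bool ^ 'n \<Rightarrow> real" where
  "sigma_bool S h x = h (fix_coords S True x) - h (fix_coords S False x)"

definition sigma_real :: "'n::finite set \<Rightarrow> (real ^ 'n \<Rightarrow> real) \<Rightarrow> real ^ 'n \<Rightarrow> real" where
  "sigma_real S h x = h (fix_coords S 1 x) - h (fix_coords S 0 x)"

end

theory Submission
  imports Defs
begin

text \<open>
  Resampling the elements outside \<open>S\<close> turns \<open>f\<close> into its conditional expectation given the
  coordinates in \<open>S\<close>. It is the orthogonal projection of \<open>f\<close> onto \<open>V S\<close>, the space of functions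
  depending only on the coordinates in \<open>S\<close>, hence the best approximation, and its values at \<open>S\<close> and
  \<open>{}\<close> differ by the mean of \<open>\<sigma>\<^sub>S f\<close>. The multilinear extension of \<open>f\<close> at \<open>p\<close> is the mean of \<open>f\<close>
  under \<open>weight p\<close>; fixing the coordinates in \<open>S\<close> makes the corresponding part of the random set
  deterministic, which gives the same two values.
\<close>

definition mean :: "real ^ 'n::finite \<Rightarrow> ('n set \<Rightarrow> real) \<Rightarrow> real" where
  "mean p F = (\<Sum>T\<in>UNIV. weight p T * F T)"

definition mix :: "'n set \<Rightarrow> 'n set \<Rightarrow> 'n set \<Rightarrow> 'n set" where
  "mix S T A = (T \<inter> S) \<union> (A - S)"

definition mix_vec :: "'n set \<Rightarrow> 'a ^ 'n::finite \<Rightarrow> 'a ^ 'n \<Rightarrow> 'a ^ 'n" where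
  "mix_vec S q p = (\<chi> i. if i \<in> S then q $ i else p $ i)"

definition cond_mean ::
  "real ^ 'n::finite \<Rightarrow> 'n set \<Rightarrow> (bool ^ 'n \<Rightarrow> real) \<Rightarrow> bool ^ 'n \<Rightarrow> real" where
  "cond_mean p S f x = mean p (\<lambda>A. f (vec_of (mix S (set_of x) A)))"

lemma set_of_vec_of [simp]: "set_of (vec_of T) = T"
  by (simp add: set_of_def vec_of_def)

lemma vec_of_set_of [simp]: "vec_of (set_of x) = x"
  by (simp add: set_of_def vec_of_def vec_eq_iff)

lemma sum_bool_vec: "(\<Sum>x\<in>UNIV. G (set_of x) x) = (\<Sum>T\<in>UNIV. G T (vec_of T))"
  by (rule sum.reindex_bij_witness[of _ vec_of set_of]) auto

section \<open>Product weights and resampling\<close>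

lemma weight_altdef: "weight p T = (\<Prod>i\<in>UNIV. if i \<in> T then p $ i else 1 - p $ i)"
  by (simp add: weight_def prod.If_cases Compl_eq_Diff_UNIV)

lemma sum_weight: "(\<Sum>T\<in>UNIV. weight p T) = 1"
proof -
  have "(\<Sum>T\<in>UNIV. weight p T) = (\<Prod>i\<in>UNIV. p $ i + (1 - p $ i))"
    by (subst prod_add) (simp_all add: weight_def)
  then show ?thesis by simp
qed

lemma mix_mix [simp]: "mix S (mix S T A) (mix S A T) = T"
  by (auto simp: mix_def)

text \<open>Index by index the same two factors occur on both sides; off \<open>S\<close> they
  merely trade places.\<close>

lemma weight_mix:
  "weight q (mix S T A) * weight p (mix S A T) =
   weight (mix_vec S q p) T * weight (mix_vec S p q) A"
  unfolding weight_altdef prod.distrib[symmetric]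
  by (rule prod.cong) (auto simp: mix_def mix_vec_def mult.commute)

text \<open>The swap \<open>(T, A) \<mapsto> (mix S T A, mix S A T)\<close> is an involution that exchanges the product
  measures in \<open>weight_mix\<close>.\<close>
lemma mean_mix_vec:
  "mean (mix_vec S q p) F = (\<Sum>T\<in>UNIV. weight q T * mean p (\<lambda>A. F (mix S T A)))"
proof -
  have "(\<Sum>T\<in>UNIV. weight q T * mean p (\<lambda>A. F (mix S T A))) =
    (\<Sum>(T, A)\<in>UNIV. weight q T * weight p A * F (mix S T A))"
    by (simp add: mean_def sum_distrib_left sum.cartesian_product mult.assoc)
  also have "\<dots> = (\<Sum>(T, A)\<in>UNIV. weight (mix_vec S q p) T * weight (mix_vec S p q) A * F T)"
    by (rule sum.reindex_bij_witness[of _ "\<lambda>(T, A). (mix S T A, mix S A T)"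
          "\<lambda>(T, A). (mix S T A, mix S A T)"])
       (auto simp: weight_mix[symmetric])
  also have "\<dots> = (\<Sum>T\<in>UNIV. weight (mix_vec S q p) T * F T * (\<Sum>A\<in>UNIV. weight (mix_vec S p q) A))"
    by (simp add: sum_distrib_left sum.cartesian_product mult_ac)
  finally show ?thesis by (simp add: sum_weight mean_def)
qed

text \<open>At the parameter vectors \<open>1\<close> and \<open>0\<close> the random set is
  deterministic, so fixing coordinates becomes a case of \<open>mix_vec\<close>.\<close>

lemma weight_1: "weight 1 T = of_bool (T = UNIV)"
  by (auto simp: weight_altdef)

lemma weight_0: "weight 0 T = of_bool (T = {})"
  by (auto simp: weight_altdef)

lemma mean_fix_coords_1: "mean (fix_coords S 1 p) F = mean p (\<lambda>A. F (mix S UNIV A))"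
proof -
  have "fix_coords S 1 p = mix_vec S 1 p"
    by (simp add: fix_coords_def mix_vec_def vec_eq_iff)
  then show ?thesis by (simp add: mean_mix_vec weight_1)
qed

lemma mean_fix_coords_0: "mean (fix_coords S 0 p) F = mean p (\<lambda>A. F (mix S {} A))"
proof -
  have "fix_coords S 0 p = mix_vec S 0 p"
    by (simp add: fix_coords_def mix_vec_def vec_eq_iff)
  then show ?thesis by (simp add: mean_mix_vec weight_0)
qed

section \<open>The multilinear extension as a mean\<close>

text \<open>A polynomial identity, valid at every real vector. After exchanging the sums, the
  coefficient of \<open>f (vec_of B)\<close> is the product of \<open>x $ i\<close> over
  \<open>B\<close> times the expanded product of \<open>1 - x $ i\<close> over the
  complement.\<close>

lemma mult_ext_eq_mean: "mult_ext f x = mean x (\<lambda>T. f (vec_of T))"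
proof -
  have "mult_ext f x =
    (\<Sum>T\<in>UNIV. \<Sum>B\<in>UNIV. of_bool (B \<subseteq> T) * ((-1) ^ (card T - card B) * f (vec_of B) * (\<Prod>i\<in>T. x $ i)))"
    by (auto simp: mult_ext_def moebius_def sum_distrib_right intro!: sum.cong sum.mono_neutral_cong_left)
  also have "\<dots> = (\<Sum>B\<in>UNIV. \<Sum>T\<in>UNIV.
      of_bool (B \<subseteq> T) * ((-1) ^ (card T - card B) * f (vec_of B) * (\<Prod>i\<in>T. x $ i)))"
    by (rule sum.swap)
  also have "\<dots> = (\<Sum>B\<in>UNIV. weight x B * f (vec_of B))"
  proof (rule sum.cong[OF refl])
    fix B :: "'a set"
    have "(\<Sum>T\<in>UNIV. of_bool (B \<subseteq> T) * ((-1) ^ (card T - card B) * f (vec_of B) * (\<Prod>i\<in>T. x $ i))) =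
       (\<Sum>T\<in>{T. B \<subseteq> T}. (-1) ^ (card T - card B) * f (vec_of B) * (\<Prod>i\<in>T. x $ i))"
      by (rule sum.mono_neutral_cong_right) auto
    \<comment> \<open>A superset of \<open>B\<close> is \<open>B\<close> plus a set \<open>D\<close>
      from its complement; the sign is absorbed by negating the factors over
      \<open>D\<close>.\<close>
    also have "\<dots> = (\<Sum>D\<in>Pow (UNIV - B). f (vec_of B) * (\<Prod>i\<in>B. x $ i) * (\<Prod>i\<in>D. - (x $ i)))"
    proof (rule sum.reindex_bij_witness[of _ "\<lambda>D. B \<union> D" "\<lambda>T. T - B"])
      fix T assume T: "T \<in> {T. B \<subseteq> T}"
      then have "(\<Prod>i\<in>T. x $ i) = (\<Prod>i\<in>B. x $ i) * (\<Prod>i\<in>T - B. x $ i)"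
        by (metis finite mem_Collect_eq mult.commute prod.subset_diff)
      moreover have "card (T - B) = card T - card B"
        using T by (simp add: card_Diff_subset)
      ultimately show "f (vec_of B) * (\<Prod>i\<in>B. x $ i) * (\<Prod>i\<in>T - B. - (x $ i)) =
          (-1) ^ (card T - card B) * f (vec_of B) * (\<Prod>i\<in>T. x $ i)"
        by (simp add: prod_uminus)
    qed auto
    also have "\<dots> = f (vec_of B) * (\<Prod>i\<in>B. x $ i) * (\<Prod>i\<in>UNIV - B. - (x $ i) + 1)"
      by (subst prod_add) (simp_all add: sum_distrib_left)
    also have "\<dots> = weight x B * f (vec_of B)"
      by (simp add: weight_def)
    finally show "(\<Sum>T\<in>UNIV. of_bool (B \<subseteq> T) *
        ((-1) ^ (card T - card B) * f (vec_of B) * (\<Prod>i\<in>T. x $ i))) = weight x B * f (vec_of B)" .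
  qed
  finally show ?thesis by (simp add: mean_def)
qed

text \<open>At the 0/1 point \<open>y\<close> with the coordinates of \<open>x\<close>, the weight
  is a point mass at \<open>set_of x\<close>, so the mean giving the multilinear extension is
  \<open>f x\<close>.\<close>

lemma moebius_inversion: "f x = (\<Sum>T\<in>UNIV. moebius f T * u T x)"
proof -
  define y :: "real ^ 'a" where "y = (\<chi> i. of_bool (x $ i))"
  have "weight y T = of_bool (T = set_of x)" for T
  proof (cases "T = set_of x")
    case False
    then obtain i where "i \<in> T \<longleftrightarrow> \<not> x $ i"
      by (auto simp: set_of_def)
    then have "(if i \<in> T then y $ i else 1 - y $ i) = 0"
      by (auto simp: y_def)
    then have "weight y T = 0"
      unfolding weight_altdef by (intro prod_zero finite bexI[of _ i] UNIV_I)
    then show ?thesis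
      using False by simp
  qed (auto simp: weight_altdef y_def set_of_def intro!: prod.neutral)
  then have "f x = mult_ext f y"
    by (simp add: mult_ext_eq_mean mean_def)
  then show ?thesis
    by (simp add: mult_ext_def u_def y_def)
qed

section \<open>Membership in \<open>V S\<close>\<close>

lemma u_mix_empty: "u T (vec_of (mix S (set_of x) {})) = of_bool (T \<subseteq> S) * u T x"
proof (cases "T \<subseteq> S")
  case True
  then show ?thesis
    by (auto simp: u_def vec_of_def set_of_def mix_def intro!: prod.cong)
next
  case False
  then obtain i where "i \<in> T" "i \<notin> S" by auto
  then show ?thesis
    using False by (auto simp: u_def vec_of_def mix_def intro!: bexI[of _ i])
qed

text \<open>Resampling alters \<open>x\<close> only off \<open>S\<close>, where no generator of
  \<open>V S\<close> looks; the invariance passes to linear combinations.\<close>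

lemma V_dep:
  assumes "g \<in> V S"
  shows "g (vec_of (mix S (set_of x) A)) = g x"
proof -
  have "\<forall>x. g (vec_of (mix S (set_of x) A)) = g x"
    using assms unfolding V_def
  proof (induction rule: fun_space.span_induct_alt)
    case (step c h g)
    then obtain T where "h = u T" "T \<subseteq> S" by auto
    moreover from this have "u T (vec_of (mix S (set_of x) A)) = u T x" for x
      by (auto simp: u_def vec_of_def set_of_def mix_def intro!: prod.cong)
    ultimately show ?case using step by (simp add: fun_scale_def)
  qed simp
  then show ?thesis by blast
qed

text \<open>Testing \<open>A = {}\<close> suffices: zeros off \<open>S\<close> kill the terms of the
  Moebius expansion of \<open>g\<close> with \<open>T\<close> not inside \<open>S\<close>, and
  generators of \<open>V S\<close> survive.\<close>

lemma V_iff: "g \<in> V S \<longleftrightarrow> (\<forall>x. g (vec_of (mix S (set_of x) {})) = g x)"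
proof (intro iffI allI)
  assume g: "\<forall>x. g (vec_of (mix S (set_of x) {})) = g x"
  have "g x = (\<Sum>T\<in>Pow S. fun_scale (moebius g T) (u T)) x" for x
  proof -
    have "g x = (\<Sum>T\<in>UNIV. moebius g T * u T (vec_of (mix S (set_of x) {})))"
      using g moebius_inversion by metis
    also have "\<dots> = (\<Sum>T\<in>Pow S. moebius g T * u T x)"
      by (rule sum.mono_neutral_cong_right) (auto simp: u_mix_empty)
    also have "\<dots> = (\<Sum>T\<in>Pow S. fun_scale (moebius g T) (u T)) x"
      by (induction rule: infinite_finite_induct) (auto simp: fun_scale_def)
    finally show ?thesis .
  qed
  then have "g = (\<Sum>T\<in>Pow S. fun_scale (moebius g T) (u T))" by blast
  also have "\<dots> \<in> V S"
    unfolding V_def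
    by (intro fun_space.span_sum fun_space.span_scale fun_space.span_base) auto
  finally show "g \<in> V S" .
qed (rule V_dep)

section \<open>The conditional mean as orthogonal projection\<close>

lemma cond_mean_in_V: "cond_mean p S f \<in> V S"
proof -
  have "mix S (mix S T {}) A = mix S T A" for T A by (auto simp: mix_def)
  then show ?thesis by (simp add: V_iff cond_mean_def)
qed

text \<open>Orthogonality of \<open>f - cond_mean p S f\<close> to \<open>V S\<close>:
  \<open>h\<close> does not feel the resampling, so it comes out of the inner mean.\<close>

lemma mean_cond_mean:
  assumes "h \<in> V S"
  shows "mean p (\<lambda>T. cond_mean p S f (vec_of T) * h (vec_of T)) =
         mean p (\<lambda>T. f (vec_of T) * h (vec_of T))"
proof -
  have h: "h (vec_of (mix S T A)) = h (vec_of T)" for T A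
    using V_dep[OF assms, of "vec_of T" A] by simp
  \<comment> \<open>With \<open>q = p\<close> in \<open>mean_mix_vec\<close>, resampling off
    \<open>S\<close> preserves the law.\<close>
  have "mix_vec S p p = p" by (simp add: mix_vec_def vec_eq_iff)
  then have "mean p (\<lambda>T. f (vec_of T) * h (vec_of T)) =
     (\<Sum>T\<in>UNIV. weight p T * mean p (\<lambda>A. f (vec_of (mix S T A)) * h (vec_of T)))"
    using mean_mix_vec[of S p p "\<lambda>T. f (vec_of T) * h (vec_of T)"] by (simp add: h)
  then show ?thesis
    by (simp add: mean_def cond_mean_def sum_distrib_right mult.assoc)
qed

text \<open>Pythagoras: the cross term is twice the mean of \<open>f - ?c\<close> times
  \<open>h\<close>, where \<open>h = ?c - g\<close> lies in \<open>V S\<close>.\<close>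

lemma sq_dist_cond_mean:
  assumes "g \<in> V S"
  shows "sq_dist p f g = sq_dist p f (cond_mean p S f) + sq_dist p (cond_mean p S f) g"
proof -
  let ?c = "cond_mean p S f"
  define h where "h = ?c - g"
  have "h \<in> V S"
    using cond_mean_in_V[of p S f] assms unfolding h_def V_def by (rule fun_space.span_diff)
  then have "mean p (\<lambda>T. f (vec_of T) * h (vec_of T)) - mean p (\<lambda>T. ?c (vec_of T) * h (vec_of T)) = 0"
    by (simp add: mean_cond_mean)
  moreover have "sq_dist p f g = sq_dist p f ?c + sq_dist p ?c g +
     2 * (mean p (\<lambda>T. f (vec_of T) * h (vec_of T)) - mean p (\<lambda>T. ?c (vec_of T) * h (vec_of T)))"
    by (simp add: sq_dist_def mean_def sum.distrib[symmetric] sum_subtractf[symmetric]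
        sum_distrib_left h_def power2_eq_square algebra_simps)
  ultimately show ?thesis by simp
qed

text \<open>Pythagoras makes the conditional mean a minimizer. The strict bounds on \<open>p\<close>
  make all weights positive, so distance zero forces equality and the minimizer is unique.\<close>

lemma best_approx_eq_cond_mean:
  assumes p: "\<And>i. 0 < p $ i \<and> p $ i < 1"
  shows "best_approx p S f = cond_mean p S f"
proof -
  let ?c = "cond_mean p S f"
  have w: "weight p T > 0" for T
    using p unfolding weight_altdef by (intro prod_pos) simp
  have nonneg: "sq_dist p ?c g \<ge> 0" for g
    unfolding sq_dist_def by (intro sum_nonneg mult_nonneg_nonneg less_imp_le[OF w]) simp
  have "sq_dist p f ?c \<le> sq_dist p f g" if "g \<in> V S" for g
    using sq_dist_cond_mean[OF that, of p f] nonneg[of g] by linarith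
  then have min: "is_arg_min (sq_dist p f) (\<lambda>g. g \<in> V S) ?c"
    by (simp add: is_arg_min_def cond_mean_in_V not_less)
  have "g = ?c" if g: "is_arg_min (sq_dist p f) (\<lambda>g. g \<in> V S) g" for g
  proof -
    have "g \<in> V S" "\<not> sq_dist p f ?c < sq_dist p f g"
      using g by (auto simp: is_arg_min_def cond_mean_in_V)
    then have "sq_dist p ?c g = 0"
      using sq_dist_cond_mean[of g S p f] nonneg[of g] by linarith
    then have "\<forall>T\<in>UNIV. weight p T * (?c (vec_of T) - g (vec_of T))\<^sup>2 = 0"
      unfolding sq_dist_def using less_imp_le[OF w] by (subst (asm) sum_nonneg_eq_0_iff) auto
    then have eq: "?c (vec_of T) = g (vec_of T)" for T
      using less_imp_neq[OF w[of T]] by simp metis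
    show "g = ?c"
    proof
      show "g x = ?c x" for x
        using eq[of "set_of x"] by simp
    qed
  qed
  with min show ?thesis
    unfolding best_approx_def by (rule the_equality)
qed

section \<open>The mean of \<open>sigma_bool\<close> and its expectation form\<close>

lemma sigma_bool_vec_of:
  "sigma_bool S f (vec_of A) = f (vec_of (mix S UNIV A)) - f (vec_of (mix S {} A))"
proof -
  have "fix_coords S True (vec_of A) = vec_of (mix S UNIV A)"
    and "fix_coords S False (vec_of A) = vec_of (mix S {} A)"
    by (auto simp: fix_coords_def vec_of_def mix_def vec_eq_iff)
  then show ?thesis by (simp add: sigma_bool_def)
qed

lemma mean_sigma_bool:
  "mean p (\<lambda>T. sigma_bool S f (vec_of T)) =
   mean p (\<lambda>A. f (vec_of (mix S UNIV A))) - mean p (\<lambda>A. f (vec_of (mix S {} A)))"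
  by (simp add: mean_def sigma_bool_vec_of right_diff_distrib sum_subtractf)

text \<open>On a finite range, \<open>F (C \<omega>)\<close> is a linear combination of indicators
  of the level sets of \<open>C\<close>.\<close>

lemma (in prob_space) expectation_finite_image:
  fixes F :: "'b::finite \<Rightarrow> real"
  assumes C: "C \<in> measurable M (count_space UNIV)"
  shows "expectation (\<lambda>\<omega>. F (C \<omega>)) = (\<Sum>T\<in>UNIV. prob {\<omega> \<in> space M. C \<omega> = T} * F T)"
proof -
  have sets: "{\<omega> \<in> space M. C \<omega> = T} \<in> events" for T
    using C by simp
  have "expectation (\<lambda>\<omega>. F (C \<omega>)) =
      expectation (\<lambda>\<omega>. \<Sum>T\<in>UNIV. indicator {\<omega> \<in> space M. C \<omega> = T} \<omega> * F T)"
  proof (rule Bochner_Integration.integral_cong[OF refl])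
    fix \<omega> assume "\<omega> \<in> space M"
    then have "indicator {\<omega> \<in> space M. C \<omega> = T} \<omega> * F T = (if C \<omega> = T then F T else 0)" for T
      by simp
    then show "F (C \<omega>) = (\<Sum>T\<in>UNIV. indicator {\<omega> \<in> space M. C \<omega> = T} \<omega> * F T)"
      by simp
  qed
  also have "\<dots> = (\<Sum>T\<in>UNIV. prob {\<omega> \<in> space M. C \<omega> = T} * F T)"
    using sets by (subst Bochner_Integration.integral_sum) (simp_all add: emeasure_eq_measure)
  finally show ?thesis .
qed

theorem proposition3p7:
  fixes p :: "real ^ 'n::finite"
    and f :: "bool ^ 'n \<Rightarrow> real"
    and S :: "'n set"
  assumes p: "\<And>i. 0 < p $ i \<and> p $ i < 1"
  shows "banzhaf_influence p f S = sigma_real S (mult_ext f) p \<and>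
         sigma_real S (mult_ext f) p = (\<Sum>x\<in>UNIV. weight p (set_of x) * sigma_bool S f x) \<and>
         (\<forall>(M :: 'w measure) C.
            prob_space M \<and> C \<in> measurable M (count_space UNIV) \<and>
            (\<forall>T. measure M {\<omega> \<in> space M. C \<omega> = T} = weight p T) \<longrightarrow>
            (\<Sum>x\<in>UNIV. weight p (set_of x) * sigma_bool S f x) =
              (\<integral>\<omega>. sigma_bool S f (vec_of (C \<omega>)) \<partial>M))"
proof -
  \<comment> \<open>All four quantities are compared with this common mean.\<close>
  let ?m = "mean p (\<lambda>T. sigma_bool S f (vec_of T))"
  have sum: "(\<Sum>x\<in>UNIV. weight p (set_of x) * sigma_bool S f x) = ?m"
    unfolding mean_def by (rule sum_bool_vec)
  \<comment> \<open>The index evaluates at \<open>S\<close>, while \<open>sigma_bool\<close> leads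
    to \<open>UNIV\<close>; \<open>mix S\<close> sees only the part inside \<open>S\<close>.\<close>
  have "mix S S A = mix S UNIV A" for A by (auto simp: mix_def)
  then have B: "banzhaf_influence p f S = ?m"
    by (simp add: banzhaf_influence_def best_approx_eq_cond_mean[OF p] cond_mean_def mean_sigma_bool)
  have R: "sigma_real S (mult_ext f) p = ?m"
    by (simp add: sigma_real_def mult_ext_eq_mean mean_fix_coords_1 mean_fix_coords_0 mean_sigma_bool)
  have E: "?m = (\<integral>\<omega>. sigma_bool S f (vec_of (C \<omega>)) \<partial>M)"
    if "prob_space M" "C \<in> measurable M (count_space UNIV)"
      "\<forall>T. measure M {\<omega> \<in> space M. C \<omega> = T} = weight p T" for M :: "'w measure" and C
    using prob_space.expectation_finite_image[OF that(1,2), of "\<lambda>T. sigma_bool S f (vec_of T)"] that(3)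
    by (simp add: mean_def)
  show ?thesis unfolding sum B R using E by simp
qed

end
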